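(* Let $n\ge 1$ and let $\mathfrak H_n$ be the Heisenberg Lie-Yamaguti algebra with center $\mathcal Z(\mathfrak H_n)=\mathrm{span}\{e\}$ and quotient $\overline{\mathfrak H}_n=\mathfrak H_n/\mathcal Z(\mathfrak H_n)$. Let $(\phi,\psi)\in\mathrm{Aut}(\mathcal Z(\mathfrak H_n))\times\mathrm{Aut}(\overline{\mathfrak H}_n)$, where $\phi(e)=\kappa e$ with $\kappa\in\mathbb K$, $\kappa\ne0$, and $\psi$ has block matrix $\begin{bmatrix}A&B\\ C&D\end{bmatrix}$ (with $n\times n$ blocks) in the basis $\bar e_1,\dots,\bar e_{2n}$. Then $(\phi,\psi)$ is inducible if and only if the following conditions hold. \begin{enumerate} \item $A^{t}D-C^{t}B=\kappa I_{n}$. \item $A^{t}C$ and $B^{t}D$ are symmetric matrices. \item $A^t\mathcal M^{\sigma}_{(ac,bd)}=\kappa E_{\sigma,\sigma}$ for all $1\le\sigma\le n$, where $E_{\sigma,\sigma}$ is the $n\times n$ matrix whose only non-zero entry is a $1$ in position $(\sigma,\sigma)$. \item For all $1\le\sigma\le n$: (a) $A^t\mathcal M^{\sigma}_{(ac,ac)}=0=B^t\mathcal M^{\sigma}_{(ac,ac)}$; (b) $A^t\mathcal M^{\sigma}_{(bd,bd)}=0=B^t\mathcal M^{\sigma}_{(bd,bd)}$; (c) $B^t\mathcal M^{\sigma}_{(ac,bd)}=0$. \end{enumerate}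
   Context: $\mathbb K$ is a field of characteristic zero. A Lie-Yamaguti algebra is a $\mathbb K$-vector space $L$ with a bilinear operation $[\cdot,\cdot]$ and a trilinear operation $\{\cdot,\cdot,\cdot\}$ such that for all $a,b,c,x,y,z$: (LY1) $[a,b]=-[b,a]$; (LY2) $\{a,b,c\}=-\{b,a,c\}$; (LY3) $[[a,b],c]+\{a,b,c\}+[[b,c],a]+\{b,c,a\}+[[c,a],b]+\{c,a,b\}=0$; (LY4) $\{[a,b],c,x\}+\{[b,c],a,x\}+\{[c,a],b,x\}=0$; (LY5) $\{a,b,[x,y]\}=[\{a,b,x\},y]+[x,\{a,b,y\}]$; (LY6) $\{a,b,\{x,y,z\}\}=\{\{a,b,x\},y,z\}+\{x,\{a,b,y\},z\}+\{x,y,\{a,b,z\}\}$. $\mathrm{Aut}$ denotes the group of bijective linear self-maps preserving both operations. The center is $\mathcal Z(L)=\{a\in L:[a,x]=0,\ \{a,x,y\}=0=\{x,y,a\}\ \forall x,y\in L\}$. The Heisenberg Lie-Yamaguti algebra $\mathfrak H_n$ is the $(2n+1)$-dimensional vector space with basis $e,e_1,\dots,e_{2n}$ and brackets $[e_i,e_{n+i}]=e$, $\{e_i,e_{n+i},e_i\}=e$ for $1\le i\le n$, all other brackets of basis elements being zero or determined by these through skew-symmetry (LY1), (LY2). Its center is $\mathrm{span}\{e\}$ and the quotient $\overline{\mathfrak H}_n$, with basis $\bar e_i=p(e_i)$ ($p:\mathfrak H_n\to\overline{\mathfrak H}_n$ the projection), is an abelian Lie-Yamaguti algebra (both brackets zero).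 A pair $(\phi,\psi)\in\mathrm{Aut}(\mathcal Z(\mathfrak H_n))\times\mathrm{Aut}(\overline{\mathfrak H}_n)$ is inducible if there is $\gamma\in\mathrm{Aut}(\mathfrak H_n)$ with $\gamma(\mathcal Z(\mathfrak H_n))=\mathcal Z(\mathfrak H_n)$, $\gamma|_{\mathcal Z(\mathfrak H_n)}=\phi$ and $p\circ\gamma=\psi\circ p$. Matrix convention: with $A=(a_{i,j})$, $B=(b_{i,j})$, $C=(c_{i,j})$, $D=(d_{i,j})$, one has for $1\le\iota\le n$: $\psi(\bar e_\iota)=\sum_{r=1}^n a_{r,\iota}\bar e_r+\sum_{r=1}^n c_{r,\iota}\bar e_{n+r}$ and $\psi(\bar e_{n+\iota})=\sum_{r=1}^n b_{r,\iota}\bar e_r+\sum_{r=1}^n d_{r,\iota}\bar e_{n+r}$. For $1\le\sigma\le n$, $\mathcal M^\sigma_{(ac,bd)}$ is the $n\times n$ matrix whose $(r,j)$ entry is $\begin{vmatrix}a_{r,j}&c_{r,j}\\ b_{r,\sigma}&d_{r,\sigma}\end{vmatrix}=a_{r,j}d_{r,\sigma}-c_{r,j}b_{r,\sigma}$. Likewise $\mathcal M^\sigma_{(ac,ac)}$ has $(r,j)$ entry $a_{r,j}c_{r,\sigma}-c_{r,j}a_{r,\sigma}$ and $\mathcal M^\sigma_{(bd,bd)}$ has $(r,j)$ entry $b_{r,j}d_{r,\sigma}-d_{r,j}b_{r,\sigma}$. *)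

theory Defs
  imports "HOL-Analysis.Finite_Cartesian_Product" "HOL-Analysis.Cartesian_Space"
begin

section \<open>Lie-Yamaguti algebras\<close>

locale lie_yamaguti = vector_space scale
  for scale :: "'k::field_char_0 \<Rightarrow> 'v::ab_group_add \<Rightarrow> 'v" +
  fixes brk :: "'v \<Rightarrow> 'v \<Rightarrow> 'v"
    and tri :: "'v \<Rightarrow> 'v \<Rightarrow> 'v \<Rightarrow> 'v"
  assumes brk_linear1: "Vector_Spaces.linear scale scale (\<lambda>a. brk a b)"
    and brk_linear2: "Vector_Spaces.linear scale scale (\<lambda>b. brk a b)"
    and tri_linear1: "Vector_Spaces.linear scale scale (\<lambda>a. tri a b c)"
    and tri_linear2: "Vector_Spaces.linear scale scale (\<lambda>b. tri a b c)"
    and tri_linear3: "Vector_Spaces.linear scale scale (\<lambda>c. tri a b c)"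
    and LY1: "brk a b = - brk b a"
    and LY2: "tri a b c = - tri b a c"
    and LY3: "brk (brk a b) c + tri a b c + brk (brk b c) a + tri b c a
                + brk (brk c a) b + tri c a b = 0"
    and LY4: "tri (brk a b) c x + tri (brk b c) a x + tri (brk c a) b x = 0"
    and LY5: "tri a b (brk x y) = brk (tri a b x) y + brk x (tri a b y)"
    and LY6: "tri a b (tri x y z)
                = tri (tri a b x) y z + tri x (tri a b y) z + tri x y (tri a b z)"

definition ly_center ::
  "('v::zero \<Rightarrow> 'v \<Rightarrow> 'v) \<Rightarrow> ('v \<Rightarrow> 'v \<Rightarrow> 'v \<Rightarrow> 'v) \<Rightarrow> 'v set" where
  "ly_center brk tri = {a. \<forall>x y. brk a x = 0 \<and> tri a x y = 0 \<and> tri x y a = 0}"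

text \<open>Automorphisms of the subalgebra with underlying set \<open>S\<close> (\<open>S = UNIV\<close> for the whole algebra).
  They are represented by total functions of which only the values on \<open>S\<close> are relevant.\<close>

definition ly_Aut ::
  "('k \<Rightarrow> 'v::ab_group_add \<Rightarrow> 'v) \<Rightarrow> ('v \<Rightarrow> 'v \<Rightarrow> 'v) \<Rightarrow> ('v \<Rightarrow> 'v \<Rightarrow> 'v \<Rightarrow> 'v) \<Rightarrow> 'v set
    \<Rightarrow> ('v \<Rightarrow> 'v) set" where
  "ly_Aut smul brk tri S = {f. bij_betw f S S
     \<and> (\<forall>x\<in>S. \<forall>y\<in>S. f (x + y) = f x + f y)
     \<and> (\<forall>c. \<forall>x\<in>S. f (smul c x) = smul c (f x))
     \<and> (\<forall>x\<in>S. \<forall>y\<in>S. f (brk x y) = brk (f x) (f y))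
     \<and> (\<forall>x\<in>S. \<forall>y\<in>S. \<forall>z\<in>S. f (tri x y z) = tri (f x) (f y) (f z))}"

definition ly_inducible ::
  "('k \<Rightarrow> 'v::ab_group_add \<Rightarrow> 'v) \<Rightarrow> ('v \<Rightarrow> 'v \<Rightarrow> 'v) \<Rightarrow> ('v \<Rightarrow> 'v \<Rightarrow> 'v \<Rightarrow> 'v)
    \<Rightarrow> ('v \<Rightarrow> 'q) \<Rightarrow> ('v \<Rightarrow> 'v) \<Rightarrow> ('q \<Rightarrow> 'q) \<Rightarrow> bool" where
  "ly_inducible smul brk tri p \<phi> \<psi> \<longleftrightarrow>
     (\<exists>\<gamma>\<in>ly_Aut smul brk tri UNIV.
        \<gamma> ` ly_center brk tri = ly_center brk tri
      \<and> (\<forall>z\<in>ly_center brk tri. \<gamma> z = \<phi> z)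
      \<and> p \<circ> \<gamma> = \<psi> \<circ> p)"


section \<open>The Heisenberg Lie-Yamaguti algebra\<close>

text \<open>The type \<open>'n\<close> plays the role of \<open>{1, \<dots>, n}\<close>, so \<open>n = CARD('n) \<ge> 1\<close>. The coordinates
  \<open>None\<close>, \<open>Some (Inl i)\<close>, \<open>Some (Inr i)\<close> belong to the basis vectors \<open>e\<close>, \<open>e\<^bsub>i\<^esub>\<close>, \<open>e\<^bsub>n+i\<^esub>\<close>.\<close>

type_synonym 'n heis_index = "('n + 'n) option"

type_synonym ('k, 'n) heis = "('k, 'n heis_index) vec"

definition heis_basis :: "'n heis_index \<Rightarrow> ('k::field_char_0, 'n::finite) heis" where
  "heis_basis i = axis i 1"

abbreviation heis_e :: "('k::field_char_0, 'n::finite) heis" where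
  "heis_e \<equiv> heis_basis None"

abbreviation heis_l :: "'n \<Rightarrow> ('k::field_char_0, 'n::finite) heis" where
  "heis_l i \<equiv> heis_basis (Some (Inl i))"

abbreviation heis_r :: "'n \<Rightarrow> ('k::field_char_0, 'n::finite) heis" where
  "heis_r i \<equiv> heis_basis (Some (Inr i))"

fun heis_brk_basis ::
  "'n heis_index \<Rightarrow> 'n heis_index \<Rightarrow> ('k::field_char_0, 'n::finite) heis" where
  "heis_brk_basis (Some (Inl i)) (Some (Inr j)) = (if i = j then heis_e else 0)"
| "heis_brk_basis (Some (Inr i)) (Some (Inl j)) = (if i = j then - heis_e else 0)"
| "heis_brk_basis _ _ = 0"

fun heis_tri_basis ::
  "'n heis_index \<Rightarrow> 'n heis_index \<Rightarrow> 'n heis_index \<Rightarrow> ('k::field_char_0, 'n::finite) heis" where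
  "heis_tri_basis (Some (Inl i)) (Some (Inr j)) (Some (Inl k))
     = (if i = j \<and> k = i then heis_e else 0)"
| "heis_tri_basis (Some (Inr i)) (Some (Inl j)) (Some (Inl k))
     = (if i = j \<and> k = i then - heis_e else 0)"
| "heis_tri_basis _ _ _ = 0"

definition heis_brk ::
  "('k::field_char_0, 'n::finite) heis \<Rightarrow> ('k, 'n) heis \<Rightarrow> ('k, 'n) heis" where
  "heis_brk x y = (\<Sum>i\<in>UNIV. \<Sum>j\<in>UNIV. (x $ i * y $ j) *s heis_brk_basis i j)"

definition heis_tri ::
  "('k::field_char_0, 'n::finite) heis \<Rightarrow> ('k, 'n) heis \<Rightarrow> ('k, 'n) heis \<Rightarrow> ('k, 'n) heis" where
  "heis_tri x y z = (\<Sum>i\<in>UNIV. \<Sum>j\<in>UNIV. \<Sum>k\<in>UNIV.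
     (x $ i * y $ j * z $ k) *s heis_tri_basis i j k)"

abbreviation heis_center :: "('k::field_char_0, 'n::finite) heis set" where
  "heis_center \<equiv> ly_center heis_brk heis_tri"

lemma sum_heis_index:
  fixes f :: "'n::finite heis_index \<Rightarrow> 'b::comm_monoid_add"
  shows "(\<Sum>i\<in>UNIV. f i) = f None + (\<Sum>r\<in>UNIV. f (Some (Inl r))) + (\<Sum>r\<in>UNIV. f (Some (Inr r)))"
proof -
  have "(\<Sum>i\<in>UNIV. f i) = f None + (\<Sum>i\<in>UNIV. f (Some i))"
    by (simp add: UNIV_option_conv sum.reindex)
  also have "(\<Sum>i\<in>UNIV. f (Some i))
      = (\<Sum>r\<in>UNIV. f (Some (Inl r))) + (\<Sum>r\<in>UNIV. f (Some (Inr r)))"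
    by (subst UNIV_sum) (subst sum.union_disjoint, auto simp: sum.reindex)
  finally show ?thesis by (simp add: add.assoc)
qed

lemma heis_brk_eq:
  "heis_brk x y = (\<Sum>r\<in>UNIV. x $ Some (Inl r) * y $ Some (Inr r)
                            - x $ Some (Inr r) * y $ Some (Inl r)) *s heis_e"
proof -
  have if1: "c *s (if P then v else 0) = (if P then c *s v else 0)"
    for c :: 'a and P and v :: "'a^('b heis_index)" by simp
  show ?thesis
    by (simp add: heis_brk_def sum_heis_index if1 sum.delta sum.delta' vec.scale_sum_left
        vec.scale_left_diff_distrib sum_subtractf sum_negf cong: if_cong)
qed

lemma heis_tri_eq:
  "heis_tri x y z = (\<Sum>r\<in>UNIV. (x $ Some (Inl r) * y $ Some (Inr r)
                   - x $ Some (Inr r) * y $ Some (Inl r)) * z $ Some (Inl r)) *s heis_e"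
proof -
  have if1: "c *s (if P \<and> Q then v else 0) = (if P then if Q then c *s v else 0 else 0)"
    for c :: 'a and P Q and v :: "'a^('b heis_index)" by simp
  have if2: "(\<Sum>k\<in>UNIV. if P then g k else 0) = (if P then \<Sum>k\<in>UNIV. g k else 0)"
    for P and g :: "'b \<Rightarrow> 'a^('b heis_index)" by simp
  show ?thesis
    by (simp add: heis_tri_def sum_heis_index if1 if2 sum.delta sum.delta' vec.scale_sum_left
        vec.scale_left_diff_distrib sum_subtractf sum_negf left_diff_distrib cong: if_cong)
qed

lemma heis_brk_basis_basis: "heis_brk (heis_basis i) (heis_basis j) = heis_brk_basis i j"
  by (cases "(i, j)" rule: heis_brk_basis.cases)
    (auto simp: heis_brk_eq heis_basis_def axis_def if_distrib[of "\<lambda>x. x * _"] if_distrib[of "\<lambda>x. _ * x"]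
       sum_subtractf sum_negf vec_eq_iff cong: if_cong)

lemma heis_tri_basis_basis:
  "heis_tri (heis_basis i) (heis_basis j) (heis_basis k) = heis_tri_basis i j k"
  by (cases "(i, j, k)" rule: heis_tri_basis.cases)
    (auto simp: heis_tri_eq heis_basis_def axis_def if_distrib[of "\<lambda>x. x * _"] if_distrib[of "\<lambda>x. _ * x"]
       sum_subtractf sum_negf vec_eq_iff cong: if_cong)

lemma heis_lie_yamaguti:
  "lie_yamaguti (*s) (heis_brk :: ('k::field_char_0, 'n::finite) heis \<Rightarrow> _) heis_tri"
proof -
  have e: "(heis_e :: ('k, 'n) heis) $ Some i = 0" for i
    by (simp add: heis_basis_def axis_def)
  show ?thesis
    by unfold_locales
      (simp_all add: heis_brk_eq heis_tri_eq e sum.distrib sum_negf sum_subtractf sum_distrib_left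
         algebra_simps flip: vec.scale_left_distrib vec.scale_minus_left)
qed

lemma heis_center_iff: "x \<in> heis_center \<longleftrightarrow> (\<forall>i. x $ Some i = 0)"
proof
  assume x: "x \<in> heis_center"
  have "heis_brk x (heis_l r) = 0" "heis_brk x (heis_r r) = 0" for r
    using x by (simp_all add: ly_center_def)
  hence "heis_brk x (heis_l r) $ None = 0" "heis_brk x (heis_r r) $ None = 0" for r
    by simp_all
  hence "x $ Some (Inl r) = 0" "x $ Some (Inr r) = 0" for r
    by (simp_all add: heis_brk_eq heis_basis_def axis_def if_distrib[of "\<lambda>x. _ * x"]
       sum_subtractf sum_negf cong: if_cong)
  thus "\<forall>i. x $ Some i = 0"
    by (metis sum.exhaust)
next
  assume "\<forall>i. x $ Some i = 0"
  thus "x \<in> heis_center"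
    by (simp add: ly_center_def heis_brk_eq heis_tri_eq)
qed

lemma heis_center_eq_span: "(heis_center :: ('k::field_char_0, 'n::finite) heis set) = vec.span {heis_e}"
proof -
  have "(\<forall>i. x $ Some i = 0) \<longleftrightarrow> (\<exists>c. x = c *s heis_e)" for x :: "('k, 'n) heis"
  proof
    assume "\<forall>i. x $ Some i = 0"
    hence "x = x $ None *s heis_e"
      by (auto simp: vec_eq_iff heis_basis_def axis_def split: option.splits)
    thus "\<exists>c. x = c *s heis_e" ..
  qed (auto simp: heis_basis_def axis_def)
  thus ?thesis
    by (simp add: set_eq_iff heis_center_iff vec.span_singleton image_iff)
qed


section \<open>The quotient by the center\<close>

definition heis_cong :: "('k::field_char_0, 'n::finite) heis \<Rightarrow> ('k, 'n) heis \<Rightarrow> bool" where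
  "heis_cong x y \<longleftrightarrow> x - y \<in> heis_center"

lemma heis_cong_iff: "heis_cong x y \<longleftrightarrow> (\<forall>i. x $ Some i = y $ Some i)"
  by (simp add: heis_cong_def heis_center_iff)

quotient_type (overloaded) ('k, 'n) heisq = "('k::field_char_0, 'n::finite) heis" / heis_cong
  morphisms heisq_rep heis_proj
  by (rule equivpI) (auto simp: reflp_def symp_def transp_def heis_cong_iff)

instantiation heisq :: (field_char_0, finite) ab_group_add
begin

lift_definition zero_heisq :: "('a, 'b) heisq" is 0 .

lift_definition plus_heisq :: "('a, 'b) heisq \<Rightarrow> ('a, 'b) heisq \<Rightarrow> ('a, 'b) heisq" is "(+)"
  by (simp add: heis_cong_iff)

lift_definition minus_heisq :: "('a, 'b) heisq \<Rightarrow> ('a, 'b) heisq \<Rightarrow> ('a, 'b) heisq" is "(-)"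
  by (simp add: heis_cong_iff)

lift_definition uminus_heisq :: "('a, 'b) heisq \<Rightarrow> ('a, 'b) heisq" is uminus
  by (simp add: heis_cong_iff)

instance
  by standard (transfer, simp add: heis_cong_iff algebra_simps)+

end

lift_definition heisq_scale ::
  "'k \<Rightarrow> ('k::field_char_0, 'n::finite) heisq \<Rightarrow> ('k, 'n) heisq" is "(*s)"
  by (simp add: heis_cong_iff)

lift_definition heisq_brk ::
  "('k::field_char_0, 'n::finite) heisq \<Rightarrow> ('k, 'n) heisq \<Rightarrow> ('k, 'n) heisq" is heis_brk
  by (simp add: heis_cong_iff heis_brk_eq)

lift_definition heisq_tri ::
  "('k::field_char_0, 'n::finite) heisq \<Rightarrow> ('k, 'n) heisq \<Rightarrow> ('k, 'n) heisq \<Rightarrow> ('k, 'n) heisq"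
  is heis_tri
  by (simp add: heis_cong_iff heis_tri_eq)

lemma heisq_abelian: "heisq_brk x y = 0" "heisq_tri x y z = 0"
  by (transfer, simp add: heis_cong_iff heis_brk_eq heis_tri_eq heis_basis_def axis_def)+

lemma heisq_lie_yamaguti:
  "lie_yamaguti heisq_scale (heisq_brk :: ('k::field_char_0, 'n::finite) heisq \<Rightarrow> _) heisq_tri"
proof -
  have "heisq_scale a (x + y) = heisq_scale a x + heisq_scale a y"
    "heisq_scale (a + b) x = heisq_scale a x + heisq_scale b x"
    "heisq_scale a (heisq_scale b x) = heisq_scale (a * b) x"
    "heisq_scale 1 x = x"
    "heisq_scale a 0 = 0"
    for a b :: 'k and x y :: "('k, 'n) heisq"
    by (transfer, simp add: heis_cong_iff algebra_simps)+
  thus ?thesis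
    by unfold_locales (simp_all add: heisq_abelian)
qed


section \<open>Matrices\<close>

text \<open>\<open>minor_matrix X Y U V \<sigma>\<close> has \<open>(r, j)\<close> entry
  \<open>det [[x\<^sub>r\<^sub>j, y\<^sub>r\<^sub>j], [u\<^sub>r\<^sub>\<sigma>, v\<^sub>r\<^sub>\<sigma>]]\<close>; thus \<open>minor_matrix A C B D \<sigma>\<close> is the matrix with
  subscript \<open>(ac,bd)\<close>.\<close>

definition minor_matrix ::
  "'k::comm_ring_1^'n^'n \<Rightarrow> 'k^'n^'n \<Rightarrow> 'k^'n^'n \<Rightarrow> 'k^'n^'n \<Rightarrow> 'n::finite \<Rightarrow> 'k^'n^'n" where
  "minor_matrix X Y U V \<sigma> = (\<chi> r j. X $ r $ j * V $ r $ \<sigma> - Y $ r $ j * U $ r $ \<sigma>)"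

definition matrix_unit :: "'n::finite \<Rightarrow> 'n \<Rightarrow> 'k::zero_neq_one^'n^'n" where
  "matrix_unit s t = (\<chi> i j. if i = s \<and> j = t then 1 else 0)"

definition has_block_matrix ::
  "(('k::field_char_0, 'n::finite) heisq \<Rightarrow> ('k, 'n) heisq)
    \<Rightarrow> 'k^'n^'n \<Rightarrow> 'k^'n^'n \<Rightarrow> 'k^'n^'n \<Rightarrow> 'k^'n^'n \<Rightarrow> bool" where
  "has_block_matrix \<psi> A B C D \<longleftrightarrow> (\<forall>i.
     \<psi> (heis_proj (heis_l i))
       = (\<Sum>r\<in>UNIV. heisq_scale (A $ r $ i) (heis_proj (heis_l r)))
       + (\<Sum>r\<in>UNIV. heisq_scale (C $ r $ i) (heis_proj (heis_r r)))
   \<and> \<psi> (heis_proj (heis_r i))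
       = (\<Sum>r\<in>UNIV. heisq_scale (B $ r $ i) (heis_proj (heis_l r)))
       + (\<Sum>r\<in>UNIV. heisq_scale (D $ r $ i) (heis_proj (heis_r r))))"

end

theory Submission
  imports Defs
begin

text \<open>
  Both brackets of the Heisenberg algebra factor through the quotient by the center and take values
  in the line spanned by \<open>e\<close>. Hence a linear map \<open>\<gamma>\<close> lifting \<open>\<psi>\<close> with
  \<open>\<gamma> e = \<kappa> e\<close> is multiplicative iff pulling back along \<open>\<psi>\<close> multiplies by \<open>\<kappa>\<close>
  the scalar-valued bilinear form behind \<open>[_,_]\<close> and the scalar-valued trilinear form behind
  \<open>{_,_,_}\<close>. By multilinearity this need only be tested on basis vectors. The values of the two
  forms on images of basis vectors under \<open>\<psi>\<close> are, up to sign, the entries of the matrices in the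
  theorem: those of \<open>A\<^sup>t D - C\<^sup>t B\<close> and of the skew-symmetric parts of \<open>A\<^sup>t C\<close> and
  \<open>B\<^sup>t D\<close> for the bilinear form (\<open>brk_multiplicative_iff\<close>), and those of \<open>A\<^sup>t M\<close>, \<open>B\<^sup>t M\<close> with
  \<open>M\<close> one of the three kinds of minor matrices for the trilinear form
  (\<open>tri_multiplicative_iff\<close>).

  These conditions depend on \<open>\<gamma>\<close> only through \<open>\<psi>\<close> and \<open>\<kappa>\<close>, so an inducing automorphism forces
  them, and conversely they turn an arbitrary linear lift into an automorphism. A bijective linear
  lift always exists (\<open>exists_linear_lift\<close>), because the center has a linear complement.
\<close>

section \<open>Reduction to basis vectors\<close>

lemma all_heis_index_iff:
  "(\<forall>i. P i) \<longleftrightarrow> P None \<and> (\<forall>r. P (Some (Inl r))) \<and> (\<forall>r. P (Some (Inr r)))"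
  for P :: "'n heis_index \<Rightarrow> bool"
  by (metis option.exhaust sum.exhaust)

lemma heis_e_nonzero: "heis_e \<noteq> (0 :: ('k::field_char_0, 'n::finite) heis)"
  by (simp add: heis_basis_def)

lemma heis_basis_expansion: "x = (\<Sum>i\<in>UNIV. x $ i *s heis_basis i)"
  by (simp add: heis_basis_def basis_expansion)

text \<open>
  Both sides of the multiplicativity law are multilinear, so they agree once they agree on basis
  vectors. With the products of basis vectors written as structure constants, which are \<open>0\<close> or
  \<open>\<plusminus>e\<close>, the left-hand side becomes explicit as soon as \<open>\<gamma> e\<close> is known.
\<close>

lemma brk_multiplicative_iff_basis:
  fixes \<gamma> :: "('k::field_char_0, 'n::finite) heis \<Rightarrow> ('k, 'n) heis"
  assumes lin: "Vector_Spaces.linear (*s) (*s) \<gamma>"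
  shows "(\<forall>x y. \<gamma> (heis_brk x y) = heis_brk (\<gamma> x) (\<gamma> y)) \<longleftrightarrow>
    (\<forall>i j. \<gamma> (heis_brk_basis i j) = heis_brk (\<gamma> (heis_basis i)) (\<gamma> (heis_basis j)))"
proof
  assume "\<forall>x y. \<gamma> (heis_brk x y) = heis_brk (\<gamma> x) (\<gamma> y)"
  thus "\<forall>i j. \<gamma> (heis_brk_basis i j) = heis_brk (\<gamma> (heis_basis i)) (\<gamma> (heis_basis j))"
    by (simp flip: heis_brk_basis_basis)
next
  assume hom: "\<forall>i j. \<gamma> (heis_brk_basis i j) = heis_brk (\<gamma> (heis_basis i)) (\<gamma> (heis_basis j))"
  interpret H: lie_yamaguti "(*s)" "heis_brk :: ('k, 'n) heis \<Rightarrow> _" heis_tri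
    by (rule heis_lie_yamaguti)
  interpret g: Vector_Spaces.linear "(*s)" "(*s)" \<gamma> by (rule lin)
  interpret b1: Vector_Spaces.linear "(*s)" "(*s)" "\<lambda>a. heis_brk a b" for b :: "('k, 'n) heis"
    by (rule H.brk_linear1)
  interpret b2: Vector_Spaces.linear "(*s)" "(*s)" "\<lambda>b. heis_brk a b" for a :: "('k, 'n) heis"
    by (rule H.brk_linear2)
  have expand: "\<gamma> x = (\<Sum>i\<in>UNIV. x $ i *s \<gamma> (heis_basis i))" for x
    by (subst (1) heis_basis_expansion) (simp add: g.sum g.scale)
  show "\<forall>x y. \<gamma> (heis_brk x y) = heis_brk (\<gamma> x) (\<gamma> y)"
  proof (intro allI)
    fix x y
    have "heis_brk (\<gamma> x) (\<gamma> y) = (\<Sum>i\<in>UNIV. \<Sum>j\<in>UNIV.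
        (x $ i * y $ j) *s heis_brk (\<gamma> (heis_basis i)) (\<gamma> (heis_basis j)))"
      by (simp only: expand[of x] b1.sum b1.scale)
        (simp add: expand[of y] b2.sum b2.scale vec.scale_sum_right)
    also have "\<dots> = \<gamma> (heis_brk x y)"
      by (simp add: heis_brk_def g.sum g.scale hom)
    finally show "\<gamma> (heis_brk x y) = heis_brk (\<gamma> x) (\<gamma> y)" ..
  qed
qed

lemma tri_multiplicative_iff_basis:
  fixes \<gamma> :: "('k::field_char_0, 'n::finite) heis \<Rightarrow> ('k, 'n) heis"
  assumes lin: "Vector_Spaces.linear (*s) (*s) \<gamma>"
  shows "(\<forall>x y z. \<gamma> (heis_tri x y z) = heis_tri (\<gamma> x) (\<gamma> y) (\<gamma> z)) \<longleftrightarrow>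
    (\<forall>i j k. \<gamma> (heis_tri_basis i j k)
      = heis_tri (\<gamma> (heis_basis i)) (\<gamma> (heis_basis j)) (\<gamma> (heis_basis k)))"
    (is "?all \<longleftrightarrow> ?basis")
proof
  assume ?all
  thus ?basis
    by (simp flip: heis_tri_basis_basis)
next
  assume hom: ?basis
  interpret H: lie_yamaguti "(*s)" "heis_brk :: ('k, 'n) heis \<Rightarrow> _" heis_tri
    by (rule heis_lie_yamaguti)
  interpret g: Vector_Spaces.linear "(*s)" "(*s)" \<gamma> by (rule lin)
  interpret t1: Vector_Spaces.linear "(*s)" "(*s)" "\<lambda>a. heis_tri a b c"
    for b c :: "('k, 'n) heis" by (rule H.tri_linear1)
  interpret t2: Vector_Spaces.linear "(*s)" "(*s)" "\<lambda>b. heis_tri a b c"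
    for a c :: "('k, 'n) heis" by (rule H.tri_linear2)
  interpret t3: Vector_Spaces.linear "(*s)" "(*s)" "\<lambda>c. heis_tri a b c"
    for a b :: "('k, 'n) heis" by (rule H.tri_linear3)
  have expand: "\<gamma> x = (\<Sum>i\<in>UNIV. x $ i *s \<gamma> (heis_basis i))" for x
    by (subst (1) heis_basis_expansion) (simp add: g.sum g.scale)
  show ?all
  proof (intro allI)
    fix x y z
    have "heis_tri (\<gamma> x) (\<gamma> y) (\<gamma> z) = (\<Sum>i\<in>UNIV. \<Sum>j\<in>UNIV. \<Sum>k\<in>UNIV. (x $ i * y $ j * z $ k) *s
        heis_tri (\<gamma> (heis_basis i)) (\<gamma> (heis_basis j)) (\<gamma> (heis_basis k)))"
      by (simp only: expand[of x] t1.sum t1.scale, simp only: expand[of y] t2.sum t2.scale)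
        (simp add: expand[of z] t3.sum t3.scale vec.scale_sum_right mult.assoc)
    also have "\<dots> = \<gamma> (heis_tri x y z)"
      by (simp add: heis_tri_def g.sum g.scale hom)
    finally show "\<gamma> (heis_tri x y z) = heis_tri (\<gamma> x) (\<gamma> y) (\<gamma> z)" ..
  qed
qed

section \<open>Matrix form of multiplicativity\<close>

text \<open>
  A lift of \<open>\<psi>\<close> is pinned down modulo the center, hence up to the coordinate \<open>None\<close>.
\<close>

lemma coordinates_of_lift:
  fixes \<gamma> :: "('k::field_char_0, 'n::finite) heis \<Rightarrow> ('k, 'n) heis"
  assumes "heis_proj \<circ> \<gamma> = \<psi> \<circ> heis_proj" and "has_block_matrix \<psi> A B C D"
  shows "\<gamma> (heis_l i) $ Some (Inl r) = A $ r $ i" "\<gamma> (heis_l i) $ Some (Inr r) = C $ r $ i"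
    and "\<gamma> (heis_r i) $ Some (Inl r) = B $ r $ i" "\<gamma> (heis_r i) $ Some (Inr r) = D $ r $ i"
proof -
  have proj_sum: "heis_proj (\<Sum>r\<in>S. f r) = (\<Sum>r\<in>S. heis_proj (f r))"
    for f :: "'n \<Rightarrow> ('k, 'n) heis" and S
    by (induction S rule: infinite_finite_induct)
      (simp_all add: zero_heisq_def flip: plus_heisq.abs_eq)
  have lift: "heis_proj (\<gamma> x) = \<psi> (heis_proj x)" for x
    using assms(1) by (metis comp_apply)
  have "heis_proj (\<gamma> (heis_l i)) = heis_proj ((\<Sum>r\<in>UNIV. A $ r $ i *s heis_l r)
      + (\<Sum>r\<in>UNIV. C $ r $ i *s heis_r r))"
    "heis_proj (\<gamma> (heis_r i)) = heis_proj ((\<Sum>r\<in>UNIV. B $ r $ i *s heis_l r)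
      + (\<Sum>r\<in>UNIV. D $ r $ i *s heis_r r))"
    using assms(2)
    by (simp_all add: lift has_block_matrix_def proj_sum
        flip: plus_heisq.abs_eq heisq_scale.abs_eq)
  thus "\<gamma> (heis_l i) $ Some (Inl r) = A $ r $ i" "\<gamma> (heis_l i) $ Some (Inr r) = C $ r $ i"
    "\<gamma> (heis_r i) $ Some (Inl r) = B $ r $ i" "\<gamma> (heis_r i) $ Some (Inr r) = D $ r $ i"
    by (simp_all add: heisq.abs_eq_iff heis_cong_iff heis_basis_def axis_def
        if_distrib[of "\<lambda>x. _ * x"] cong: if_cong)
qed

text \<open>
  The pair \<open>(e\<^sub>i, e\<^bsub>n+j\<^esub>)\<close> gives the \<open>(i, j)\<close> entry of \<open>A\<^sup>t D - C\<^sup>t B = \<kappa> I\<close>. The pairs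
  \<open>(e\<^sub>i, e\<^sub>j)\<close> and \<open>(e\<^bsub>n+i\<^esub>, e\<^bsub>n+j\<^esub>)\<close> give the vanishing of the skew-symmetric parts of
  \<open>A\<^sup>t C\<close> and \<open>B\<^sup>t D\<close>.
\<close>

lemma brk_multiplicative_iff:
  fixes \<gamma> :: "('k::field_char_0, 'n::finite) heis \<Rightarrow> ('k, 'n) heis"
  assumes lin: "Vector_Spaces.linear (*s) (*s) \<gamma>"
    and e: "\<gamma> heis_e = \<kappa> *s heis_e"
    and lift: "heis_proj \<circ> \<gamma> = \<psi> \<circ> heis_proj" "has_block_matrix \<psi> A B C D"
  shows "(\<forall>x y. \<gamma> (heis_brk x y) = heis_brk (\<gamma> x) (\<gamma> y)) \<longleftrightarrow>
      transpose A ** D - transpose C ** B = map_matrix ((*) \<kappa>) (mat 1)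
    \<and> transpose (transpose A ** C) = transpose A ** C
    \<and> transpose (transpose B ** D) = transpose B ** D"
proof -
  interpret H: lie_yamaguti "(*s)" "heis_brk :: ('k, 'n) heis \<Rightarrow> _" heis_tri
    by (rule heis_lie_yamaguti)
  interpret g: Vector_Spaces.linear "(*s)" "(*s)" \<gamma> by (rule lin)
  note coords = coordinates_of_lift[OF lift]
  let ?P = "\<lambda>i j. \<gamma> (heis_brk_basis i j) = heis_brk (\<gamma> (heis_basis i)) (\<gamma> (heis_basis j))"
  have center: "?P None j" "?P j None" for j
    by (cases j; simp add: e heis_brk_eq g.zero; simp add: heis_basis_def axis_def)+
  have lr: "?P (Some (Inl i)) (Some (Inr j)) \<longleftrightarrow>
      (transpose A ** D - transpose C ** B) $ i $ j = map_matrix ((*) \<kappa>) (mat 1) $ i $ j" for i j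
    by (auto simp: e g.zero heis_brk_eq coords heis_e_nonzero matrix_matrix_mult_def
        transpose_def map_matrix_def mat_def sum_subtractf)
  have skew: "?P (Some (Inr j)) (Some (Inl i)) \<longleftrightarrow> ?P (Some (Inl i)) (Some (Inr j))" for i j
    by (subst H.LY1) (auto simp: g.neg g.zero)
  have ll: "?P (Some (Inl i)) (Some (Inl j)) \<longleftrightarrow>
      transpose (transpose A ** C) $ j $ i = (transpose A ** C) $ j $ i" for i j
    by (auto simp: e g.zero heis_brk_eq coords heis_e_nonzero
        matrix_matrix_mult_def transpose_def sum_subtractf mult.commute)
  have rr: "?P (Some (Inr i)) (Some (Inr j)) \<longleftrightarrow>
      transpose (transpose B ** D) $ j $ i = (transpose B ** D) $ j $ i" for i j
    by (auto simp: e g.zero heis_brk_eq coords heis_e_nonzero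
        matrix_matrix_mult_def transpose_def sum_subtractf mult.commute)
  have "(\<forall>x y. \<gamma> (heis_brk x y) = heis_brk (\<gamma> x) (\<gamma> y)) \<longleftrightarrow> (\<forall>i j. ?P i j)"
    by (rule brk_multiplicative_iff_basis[OF lin])
  also have "\<dots> \<longleftrightarrow> (\<forall>i j. ?P (Some (Inl i)) (Some (Inr j)))
      \<and> (\<forall>j i. ?P (Some (Inl i)) (Some (Inl j))) \<and> (\<forall>j i. ?P (Some (Inr i)) (Some (Inr j)))"
    unfolding all_heis_index_iff using center skew by blast
  finally show ?thesis
    unfolding lr ll rr by (simp only: vec_eq_iff)
qed

text \<open>
  The triple with last entry \<open>e\<^sub>i\<close> (respectively \<open>e\<^bsub>n+i\<^esub>\<close>) gives the \<open>i\<close>-th row of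
  \<open>A\<^sup>t M\<close> (respectively \<open>B\<^sup>t M\<close>): only the first \<open>n\<close> coordinates of the last argument enter the
  trilinear form, and these are the columns of \<open>A\<close> and \<open>B\<close>. The first two entries, at positions \<open>j\<close>
  and \<open>\<sigma>\<close>, select the kind of minor matrix.
\<close>

lemma tri_multiplicative_iff:
  fixes \<gamma> :: "('k::field_char_0, 'n::finite) heis \<Rightarrow> ('k, 'n) heis"
  assumes lin: "Vector_Spaces.linear (*s) (*s) \<gamma>"
    and e: "\<gamma> heis_e = \<kappa> *s heis_e"
    and lift: "heis_proj \<circ> \<gamma> = \<psi> \<circ> heis_proj" "has_block_matrix \<psi> A B C D"
  shows "(\<forall>x y z. \<gamma> (heis_tri x y z) = heis_tri (\<gamma> x) (\<gamma> y) (\<gamma> z)) \<longleftrightarrow>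
      (\<forall>\<sigma>. transpose A ** minor_matrix A C B D \<sigma> = map_matrix ((*) \<kappa>) (matrix_unit \<sigma> \<sigma>))
    \<and> (\<forall>\<sigma>. (transpose A ** minor_matrix A C A C \<sigma> = 0
             \<and> transpose B ** minor_matrix A C A C \<sigma> = 0)
          \<and> (transpose A ** minor_matrix B D B D \<sigma> = 0
             \<and> transpose B ** minor_matrix B D B D \<sigma> = 0)
          \<and> transpose B ** minor_matrix A C B D \<sigma> = 0)"
proof -
  interpret H: lie_yamaguti "(*s)" "heis_brk :: ('k, 'n) heis \<Rightarrow> _" heis_tri
    by (rule heis_lie_yamaguti)
  interpret g: Vector_Spaces.linear "(*s)" "(*s)" \<gamma> by (rule lin)
  note coords = coordinates_of_lift[OF lift]
  let ?P = "\<lambda>i j k. \<gamma> (heis_tri_basis i j k)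
    = heis_tri (\<gamma> (heis_basis i)) (\<gamma> (heis_basis j)) (\<gamma> (heis_basis k))"
  let ?l = "\<lambda>i. Some (Inl i)" and ?r = "\<lambda>i. Some (Inr i)"
  have e0: "\<gamma> heis_e $ Some i = 0" for i
    by (simp add: e) (simp add: heis_basis_def axis_def)
  have center: "?P None j k" "?P j None k" "?P j k None" for j k
    by (cases "(j, k)" rule: heis_brk_basis.cases; simp add: e0 heis_tri_eq g.zero)+
  have skew: "?P (?r j) (?l i) k \<longleftrightarrow> ?P (?l i) (?r j) k" for i j :: 'n and k
    by (subst H.LY2, cases "(?l i :: 'n heis_index, ?r j :: 'n heis_index, k)" rule: heis_tri_basis.cases)
      (auto simp: g.neg g.zero)
  have lrl: "?P (?l j) (?r \<sigma>) (?l i) \<longleftrightarrow>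
      (transpose A ** minor_matrix A C B D \<sigma>) $ i $ j
        = map_matrix ((*) \<kappa>) (matrix_unit \<sigma> \<sigma>) $ i $ j" for i j \<sigma>
    by (auto simp: e g.zero heis_tri_eq coords heis_e_nonzero matrix_matrix_mult_def transpose_def
        map_matrix_def matrix_unit_def minor_matrix_def mult.commute)
  have zero:
    "?P (?l j) (?r \<sigma>) (?r i) \<longleftrightarrow> (transpose B ** minor_matrix A C B D \<sigma>) $ i $ j = 0 $ i $ j"
    "?P (?l j) (?l \<sigma>) (?l i) \<longleftrightarrow> (transpose A ** minor_matrix A C A C \<sigma>) $ i $ j = 0 $ i $ j"
    "?P (?l j) (?l \<sigma>) (?r i) \<longleftrightarrow> (transpose B ** minor_matrix A C A C \<sigma>) $ i $ j = 0 $ i $ j"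
    "?P (?r j) (?r \<sigma>) (?l i) \<longleftrightarrow> (transpose A ** minor_matrix B D B D \<sigma>) $ i $ j = 0 $ i $ j"
    "?P (?r j) (?r \<sigma>) (?r i) \<longleftrightarrow> (transpose B ** minor_matrix B D B D \<sigma>) $ i $ j = 0 $ i $ j"
    for i j \<sigma>
    by (auto simp: g.zero heis_tri_eq coords heis_e_nonzero
        matrix_matrix_mult_def transpose_def minor_matrix_def mult.commute)
  have "(\<forall>x y z. \<gamma> (heis_tri x y z) = heis_tri (\<gamma> x) (\<gamma> y) (\<gamma> z)) \<longleftrightarrow> (\<forall>i j k. ?P i j k)"
    by (rule tri_multiplicative_iff_basis[OF lin])
  also have "\<dots> \<longleftrightarrow> (\<forall>\<sigma> i j. ?P (?l j) (?r \<sigma>) (?l i))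
      \<and> (\<forall>\<sigma>. ((\<forall>i j. ?P (?l j) (?l \<sigma>) (?l i)) \<and> (\<forall>i j. ?P (?l j) (?l \<sigma>) (?r i)))
           \<and> ((\<forall>i j. ?P (?r j) (?r \<sigma>) (?l i)) \<and> (\<forall>i j. ?P (?r j) (?r \<sigma>) (?r i)))
           \<and> (\<forall>i j. ?P (?l j) (?r \<sigma>) (?r i)))"
    unfolding all_heis_index_iff by (simp only: center skew simp_thms) blast
  finally show ?thesis
    unfolding lrl zero by (simp only: vec_eq_iff)
qed

section \<open>Existence of linear lifts\<close>

text \<open>
  The kernel of the coordinate \<open>None\<close> is a complement of the center, which the projection maps
  isomorphically onto the quotient. The lift acts as \<open>\<psi>\<close> on it and as \<open>\<kappa>\<close> on the center.
\<close>

lemma exists_linear_lift: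
  fixes \<psi> :: "('k::field_char_0, 'n::finite) heisq \<Rightarrow> ('k, 'n) heisq"
  assumes lin: "Vector_Spaces.linear heisq_scale heisq_scale \<psi>" and "bij \<psi>" and "\<kappa> \<noteq> 0"
  obtains \<gamma> :: "('k, 'n) heis \<Rightarrow> ('k, 'n) heis"
  where "Vector_Spaces.linear (*s) (*s) \<gamma>" "bij \<gamma>" "\<gamma> heis_e = \<kappa> *s heis_e"
    "heis_proj \<circ> \<gamma> = \<psi> \<circ> heis_proj"
proof -
  interpret psi: Vector_Spaces.linear heisq_scale heisq_scale \<psi> by (rule lin)
  define \<gamma> :: "('k, 'n) heis \<Rightarrow> ('k, 'n) heis" where
    "\<gamma> x = (\<chi> i. if i = None then \<kappa> * x $ None else heisq_rep (\<psi> (heis_proj x)) $ i)" for x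
  have None: "\<gamma> x $ None = \<kappa> * x $ None" for x
    by (simp add: \<gamma>_def)
  have proj_eq: "heis_proj x = heis_proj y \<longleftrightarrow> (\<forall>i. x $ Some i = y $ Some i)"
    for x y :: "('k, 'n) heis"
    by (simp add: heisq.abs_eq_iff heis_cong_iff)
  have proj_rep: "heis_proj (heisq_rep q) = q" for q :: "('k, 'n) heisq"
    by (rule Quotient_abs_rep[OF Quotient_heisq])
  have proj: "heis_proj (\<gamma> x) = \<psi> (heis_proj x)" for x
  proof -
    have "heis_proj (\<gamma> x) = heis_proj (heisq_rep (\<psi> (heis_proj x)))"
      unfolding proj_eq by (simp add: \<gamma>_def)
    thus ?thesis by (simp only: proj_rep)
  qed
  have eqI: "x = y" if "heis_proj x = heis_proj y" "x $ None = y $ None" for x y :: "('k, 'n) heis"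
    using that by (simp add: proj_eq vec_eq_iff) (metis option.exhaust)
  show ?thesis
  proof (rule that)
    show "Vector_Spaces.linear (*s) (*s) \<gamma>"
    proof (intro Vector_Spaces.linear_iff[THEN iffD2] conjI allI)
      fix x y c
      show "\<gamma> (x + y) = \<gamma> x + \<gamma> y"
        by (rule eqI) (simp_all add: proj psi.add None ring_distribs flip: plus_heisq.abs_eq)
      show "\<gamma> (c *s x) = c *s \<gamma> x"
        by (rule eqI) (simp_all add: proj psi.scale None flip: heisq_scale.abs_eq)
    qed unfold_locales
    show "bij \<gamma>"
    proof (rule bijI)
      show "inj \<gamma>"
      proof (rule injI)
        fix x y assume "\<gamma> x = \<gamma> y"
        hence "\<psi> (heis_proj x) = \<psi> (heis_proj y)" "\<kappa> * x $ None = \<kappa> * y $ None"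
          by (metis proj, metis None)
        thus "x = y"
          using \<open>bij \<psi>\<close> \<open>\<kappa> \<noteq> 0\<close> by (intro eqI) (auto dest: bij_is_inj injD)
      qed
      show "surj \<gamma>"
      proof (rule surjI)
        fix y
        let ?x = "\<chi> i. if i = None then y $ None / \<kappa> else heisq_rep (inv \<psi> (heis_proj y)) $ i"
        have "heis_proj ?x = heis_proj (heisq_rep (inv \<psi> (heis_proj y)))"
          unfolding proj_eq by simp
        hence "heis_proj ?x = inv \<psi> (heis_proj y)"
          by (simp only: proj_rep)
        thus "\<gamma> ?x = y"
          using \<open>bij \<psi>\<close> \<open>\<kappa> \<noteq> 0\<close>
          by (intro eqI) (simp_all add: proj None bij_is_surj surj_f_inv_f)
      qed
    qed
    show "\<gamma> heis_e = \<kappa> *s heis_e"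
    proof (rule eqI)
      have "heis_proj heis_e = (0 :: ('k, 'n) heisq)" "heis_proj (\<kappa> *s heis_e) = (0 :: ('k, 'n) heisq)"
        unfolding zero_heisq_def proj_eq by (simp_all add: heis_basis_def axis_def)
      thus "heis_proj (\<gamma> heis_e) = heis_proj (\<kappa> *s heis_e)"
        by (simp add: proj psi.zero)
    qed (simp add: None)
    show "heis_proj \<circ> \<gamma> = \<psi> \<circ> heis_proj"
      by (simp add: fun_eq_iff proj)
  qed
qed

section \<open>Inducible pairs\<close>

theorem theorem6p4:
  fixes \<phi> :: "('k::field_char_0, 'n::finite) heis \<Rightarrow> ('k, 'n) heis"
    and \<psi> :: "('k, 'n) heisq \<Rightarrow> ('k, 'n) heisq"
    and \<kappa> :: 'k
    and A B C D :: "'k^'n^'n"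
  assumes "\<phi> \<in> ly_Aut (*s) heis_brk heis_tri heis_center"
    and "\<psi> \<in> ly_Aut heisq_scale heisq_brk heisq_tri UNIV"
    and "\<phi> heis_e = \<kappa> *s heis_e"
    and "\<kappa> \<noteq> 0"
    and "has_block_matrix \<psi> A B C D"
  shows "ly_inducible (*s) heis_brk heis_tri heis_proj \<phi> \<psi> \<longleftrightarrow>
      transpose A ** D - transpose C ** B = map_matrix ((*) \<kappa>) (mat 1)
    \<and> (transpose (transpose A ** C) = transpose A ** C
        \<and> transpose (transpose B ** D) = transpose B ** D)
    \<and> (\<forall>\<sigma>. transpose A ** minor_matrix A C B D \<sigma> = map_matrix ((*) \<kappa>) (matrix_unit \<sigma> \<sigma>))
    \<and> (\<forall>\<sigma>. (transpose A ** minor_matrix A C A C \<sigma> = 0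
             \<and> transpose B ** minor_matrix A C A C \<sigma> = 0)
          \<and> (transpose A ** minor_matrix B D B D \<sigma> = 0
             \<and> transpose B ** minor_matrix B D B D \<sigma> = 0)
          \<and> transpose B ** minor_matrix A C B D \<sigma> = 0)"
    (is "?inducible \<longleftrightarrow> ?conditions")
proof
  assume ?inducible
  then obtain \<gamma> where \<gamma>: "\<gamma> \<in> ly_Aut (*s) heis_brk heis_tri UNIV"
    and \<phi>: "\<forall>z\<in>heis_center. \<gamma> z = \<phi> z" and lift: "heis_proj \<circ> \<gamma> = \<psi> \<circ> heis_proj"
    unfolding ly_inducible_def by blast
  have lin: "Vector_Spaces.linear (*s) (*s) \<gamma>"
    using \<gamma> by (simp add: ly_Aut_def Vector_Spaces.linear_iff vec.vector_space_axioms)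
  have "heis_e \<in> (heis_center :: ('k, 'n) heis set)"
    by (simp add: heis_center_eq_span vec.span_base)
  hence e: "\<gamma> heis_e = \<kappa> *s heis_e"
    using \<phi> assms(3) by simp
  have "\<forall>x y. \<gamma> (heis_brk x y) = heis_brk (\<gamma> x) (\<gamma> y)"
    "\<forall>x y z. \<gamma> (heis_tri x y z) = heis_tri (\<gamma> x) (\<gamma> y) (\<gamma> z)"
    using \<gamma> by (simp_all add: ly_Aut_def)
  thus ?conditions
    unfolding brk_multiplicative_iff[OF lin e lift assms(5)]
      tri_multiplicative_iff[OF lin e lift assms(5)] by simp
next
  assume conditions: ?conditions
  have "Vector_Spaces.linear heisq_scale heisq_scale \<psi>"
    using assms(2) heisq_lie_yamaguti[where 'k='k and 'n='n]
    by (simp add: ly_Aut_def Vector_Spaces.linear_iff lie_yamaguti_def)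
  moreover have "bij \<psi>"
    using assms(2) by (simp add: ly_Aut_def)
  ultimately obtain \<gamma> :: "('k, 'n) heis \<Rightarrow> ('k, 'n) heis"
    where lin: "Vector_Spaces.linear (*s) (*s) \<gamma>" and "bij \<gamma>"
      and e: "\<gamma> heis_e = \<kappa> *s heis_e" and lift: "heis_proj \<circ> \<gamma> = \<psi> \<circ> heis_proj"
    using \<open>\<kappa> \<noteq> 0\<close> by (rule exists_linear_lift)
  have "\<forall>x y. \<gamma> (heis_brk x y) = heis_brk (\<gamma> x) (\<gamma> y)"
    "\<forall>x y z. \<gamma> (heis_tri x y z) = heis_tri (\<gamma> x) (\<gamma> y) (\<gamma> z)"
    unfolding brk_multiplicative_iff[OF lin e lift assms(5)]
      tri_multiplicative_iff[OF lin e lift assms(5)] using conditions by blast+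
  hence "\<gamma> \<in> ly_Aut (*s) heis_brk heis_tri UNIV"
    using lin \<open>bij \<gamma>\<close> by (simp add: ly_Aut_def Vector_Spaces.linear_iff)
  moreover have scale: "\<gamma> z = \<kappa> *s z" "\<phi> z = \<kappa> *s z" if z_center: "z \<in> heis_center" for z
  proof -
    obtain c where z: "z = c *s heis_e"
      using z_center by (auto simp: heis_center_eq_span vec.span_singleton)
    have "heis_e \<in> (heis_center :: ('k, 'n) heis set)"
      by (simp add: heis_center_eq_span vec.span_base)
    hence "\<phi> z = c *s \<phi> heis_e"
      using assms(1) by (simp add: z ly_Aut_def)
    thus "\<phi> z = \<kappa> *s z"
      by (simp add: z assms(3) mult.commute)
    show "\<gamma> z = \<kappa> *s z"
      using lin by (simp add: z Vector_Spaces.linear_iff e mult.commute)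
  qed
  moreover have "\<gamma> ` heis_center = heis_center"
  proof (intro equalityI subsetI)
    fix z assume "z \<in> \<gamma> ` heis_center"
    thus "z \<in> heis_center"
      by (auto simp: scale) (simp add: heis_center_iff)
  next
    fix z :: "('k, 'n) heis" assume "z \<in> heis_center"
    hence "inverse \<kappa> *s z \<in> heis_center"
      by (simp add: heis_center_iff)
    moreover from this have "\<gamma> (inverse \<kappa> *s z) = z"
      using \<open>\<kappa> \<noteq> 0\<close> by (simp add: scale)
    ultimately show "z \<in> \<gamma> ` heis_center"
      by (metis imageI)
  qed
  ultimately show ?inducible
    unfolding ly_inducible_def using lift by (metis (no_types, lifting))
qed

end
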